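(* Let $b=2\pi(1-\frac{1}{2\sigma})$, $\sigma>1$, $\beta=bm$, $N\in2\mathbb N$, and $N_1=\sigma N\in2\mathbb N$. Further let $m\in\mathbb N\setminus\{1\}$ with $2m\ll N_1$ be given. Then the $C(\mathbb T)$-error constant of the continuous Kaiser--Bessel window function $\varphi_{\mathrm{cKB}}$ can be estimated by $$e_\sigma(\varphi_{\mathrm{cKB}})\le 16\,m\pi\sqrt{1-1/\sigma}\,\Big[e^{2\pi m\sqrt{1-1/\sigma}}-e^{-2\pi m\sqrt{1-1/\sigma}}-4\sqrt{\sigma^2-\sigma}\Big]^{-1}.$$
   Context: $\mathbb N=\{1,2,\dots\}$, $I_N:=\{-N/2,\dots,N/2-1\}$ for $N\in2\mathbb N$, $\mathbb T=\mathbb R/\mathbb Z$, and $C(\mathbb T)$ is the Banach space of continuous 1-periodic functions with the sup-norm $\|\cdot\|_{C(\mathbb T)}$. Here $\sigma$ is the oversampling factor, $m$ the truncation parameter and $\beta$ the shape parameter; $2m\ll N_1$ means that $2m$ is much smaller than $N_1$. The Fourier transform is $\hat\varphi(v):=\int_{\mathbb R}\varphi(x)e^{-2\pi i vx}\,dx$. The continuous Kaiser--Bessel window function is $$\varphi_{\mathrm{cKB}}(x):=\frac{1}{I_0(\beta)-1}\Big(I_0\big(\beta\sqrt{1-(N_1x/m)^2}\big)-1\Big)\ \text{ for } x\in I:=\big(-\tfrac{m}{N_1},\tfrac{m}{N_1}\big),\qquad \varphi_{\mathrm{cKB}}(x):=0\ \text{ for } x\in\mathbb R\setminus I,$$ where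 $I_0(x)=\sum_{k=0}^\infty\frac{1}{(k!)^2}\big(\frac{x}{2}\big)^{2k}$ is the modified Bessel function of first kind. The $C(\mathbb T)$-error constant of a window function $\varphi$ is $$e_\sigma(\varphi):=\sup_{N\in2\mathbb N}e_{\sigma,N}(\varphi),\qquad e_{\sigma,N}(\varphi):=\max_{n\in I_N}\Big\|\sum_{r\in\mathbb Z\setminus\{0\}}\frac{\hat\varphi(n+rN_1)}{\hat\varphi(n)}\,e^{2\pi i rN_1\,\cdot}\Big\|_{C(\mathbb T)}.$$
   Formalization: The bracket on the right-hand side is additionally assumed to be positive; otherwise the bound is negative or undefined while the error constant is nonnegative (for example m = 2, σ = 100000, N = 2). *)

theory Defs
  imports "HOL-Analysis.Analysis"
begin

text \<open>Modified Bessel function of the first kind of order zero.\<close>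

definition bessel_I0 :: "real \<Rightarrow> real" where
  "bessel_I0 x = (\<Sum>k. 1 / (fact k)\<^sup>2 * (x / 2) ^ (2 * k))"

text \<open>Continuous Kaiser--Bessel window with truncation parameter \<open>m\<close>, shape parameter \<open>\<beta>\<close>
  and \<open>N1\<close> the oversampled length.\<close>

definition cKB :: "nat \<Rightarrow> real \<Rightarrow> nat \<Rightarrow> real \<Rightarrow> real" where
  "cKB m \<beta> N1 x =
     (if x \<in> {- (real m / real N1) <..< real m / real N1}
      then 1 / (bessel_I0 \<beta> - 1)
             * (bessel_I0 (\<beta> * sqrt (1 - (real N1 * x / real m)\<^sup>2)) - 1)
      else 0)"

definition fourier :: "(real \<Rightarrow> real) \<Rightarrow> real \<Rightarrow> complex" where
  "fourier \<phi> v =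
     (LINT x|lborel. complex_of_real (\<phi> x) * exp (- 2 * of_real pi * \<i> * of_real v * of_real x))"

definition freqs :: "nat \<Rightarrow> int set" where
  "freqs N = {- (int N div 2) .. int N div 2 - 1}"

text \<open>The space of continuous 1-periodic functions on the line is a closed subspace of the Banach
  space of bounded continuous functions \<open>real \<Rightarrow>\<^sub>C complex\<close>, and the norm of the latter is the
  sup-norm. The series below consists of 1-periodic functions, so it may be summed in the larger
  space without changing its convergence, its sum or the norm of the sum.\<close>

lemma scaled_exp_bcontfun:
  "(\<lambda>x::real. c * exp (2 * of_real pi * \<i> * of_int k * of_real x) :: complex) \<in> bcontfun"
proof -
  have "norm (c * exp (2 * of_real pi * \<i> * of_int k * of_real x)) = norm c" for x :: real
    by (simp add: norm_mult norm_exp_eq_Re)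
  then show ?thesis
    by (intro bcontfun_normI[where b = "norm c"] continuous_intros) simp
qed

text \<open>The coefficient is part of the definition because \<open>real \<Rightarrow>\<^sub>C complex\<close> is only a real vector
  space. By the preceding lemma, the argument of \<open>Bcontfun\<close> is a bounded continuous function.\<close>

definition scaled_exp :: "complex \<Rightarrow> int \<Rightarrow> (real \<Rightarrow>\<^sub>C complex)" where
  "scaled_exp c k = Bcontfun (\<lambda>x. c * exp (2 * of_real pi * \<i> * of_int k * of_real x))"

lemma apply_scaled_exp:
  "apply_bcontfun (scaled_exp c k) x = c * exp (2 * of_real pi * \<i> * of_int k * of_real x)"
  by (simp add: scaled_exp_def Bcontfun_inverse[OF scaled_exp_bcontfun])

definition alias_term :: "nat \<Rightarrow> (real \<Rightarrow> real) \<Rightarrow> int \<Rightarrow> int \<Rightarrow> (real \<Rightarrow>\<^sub>C complex)" where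
  "alias_term N1 \<phi> n r =
     scaled_exp (fourier \<phi> (of_int (n + r * int N1)) / fourier \<phi> (of_int n)) (r * int N1)"

text \<open>The value \<open>\<infinity>\<close> is assigned when the quotients or the series are not defined, so that an upper
  bound on the error constant cannot hold because of the conventions \<open>x / 0 = 0\<close> and
  \<open>infsum f A = 0\<close> for non-summable \<open>f\<close>.\<close>

definition err_N :: "nat \<Rightarrow> nat \<Rightarrow> (real \<Rightarrow> real) \<Rightarrow> ereal" where
  "err_N N N1 \<phi> =
     (if \<forall>n \<in> freqs N. fourier \<phi> (of_int n) \<noteq> 0 \<and> alias_term N1 \<phi> n summable_on (UNIV - {0})
      then ereal (Max ((\<lambda>n. norm (\<Sum>\<^sub>\<infinity>r\<in>UNIV - {0}. alias_term N1 \<phi> n r)) ` freqs N))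
      else \<infinity>)"

text \<open>A window function is really a family indexed by the oversampled length \<open>N1 = \<sigma> N\<close>. The supremum
  is over all positive even \<open>N\<close> for which \<open>\<sigma> N\<close> is an even integer. No lower
  bound on \<open>N1\<close> in terms of \<open>m\<close> is imposed inside the supremum.\<close>

definition err :: "real \<Rightarrow> (nat \<Rightarrow> real \<Rightarrow> real) \<Rightarrow> ereal" where
  "err \<sigma> \<phi> =
     (SUP (N, N1) \<in> {(N, N1). N > 0 \<and> even N \<and> even N1 \<and> real N1 = \<sigma> * real N}.
        err_N N N1 (\<phi> N1))"

end

theory Submission
  imports Defs
begin

text \<open>Up to a constant factor that cancels in all quotients, the Fourier transform of the window is
  the difference of two values of one entire function,
  \<open>h w = F (\<beta>\<^sup>2 - w\<^sup>2) - F (- (w\<^sup>2))\<close> with \<open>w = 2 * pi * m * v / N1\<close> and \<open>F x = sinh (sqrt x) / sqrt x\<close>,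
  where \<open>F (- (y\<^sup>2)) = sin y / y\<close> (lemma \<open>fourier_cKB\<close>). This follows by integrating the Cauchy product
  of two power series term by term (lemma \<open>has_bochner_integral_bessel_cos\<close>).

  Put \<open>w0 = pi * m / \<sigma>\<close>, so that \<open>\<beta> = 2 * pi * m - w0\<close>, and let \<open>S = 2 * pi * m * sqrt (1 - 1 / \<sigma>)\<close>,
  which satisfies \<open>S\<^sup>2 = \<beta>\<^sup>2 - w0\<^sup>2\<close>.

  Denominators. The frequencies \<open>n\<close> correspond to \<open>\<bar>w\<bar> \<le> w0\<close>. There \<open>h\<close> decreases in \<open>\<bar>w\<bar>\<close>, because
  the slope of \<open>F\<close> is at least \<open>1 / 6\<close> at positive and at most \<open>1 / 6\<close> at negative arguments. Hence
  \<open>h w \<ge> h w0 \<ge> sinh S / S - 1 / w0\<close> (lemma \<open>sinhc_sqrt_diff_lower_bound\<close>).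

  Numerators. The alias with index \<open>r\<close> corresponds to some \<open>w\<close> with \<open>\<bar>w\<bar> \<ge> \<bar>r\<bar> * \<beta>\<close>. For
  \<open>\<bar>w\<bar> \<ge> \<beta> \<ge> 2 * pi\<close> one has \<open>\<bar>h w\<bar> \<le> 6 / 5 * (\<beta> / w)\<^sup>2\<close> (lemma \<open>sinhc_sqrt_diff_decay\<close>), so the
  numerators sum up to at most \<open>6 / 5 * (pi\<^sup>2 / 3) \<le> 4\<close>.

  The quotient \<open>4 / (sinh S / S - 1 / w0)\<close> is the claimed bound, and it is the same for all \<open>N\<close>.\<close>

section \<open>The hyperbolic cardinal sine of a square root\<close>

text \<open>The entire function that is \<open>sinh (sqrt x) / sqrt x\<close> for \<open>x > 0\<close> and
  \<open>sin (sqrt (- x)) / sqrt (- x)\<close> for \<open>x < 0\<close>. One power series replaces the usual case distinction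
  at \<open>\<bar>w\<bar> = \<beta>\<close> in the transform of the window.\<close>

definition sinhc_sqrt :: "real \<Rightarrow> real" where
  "sinhc_sqrt x = (\<Sum>n. x ^ n / fact (2 * n + 1))"

lemma sinhc_sqrt_sums: "(\<lambda>n. x ^ n / fact (2 * n + 1)) sums sinhc_sqrt x"
proof -
  have "summable (\<lambda>n. inverse (fact n) *\<^sub>R \<bar>x\<bar> ^ n)"
    by (rule summable_exp_generic)
  moreover have "norm (x ^ n / fact (2 * n + 1)) \<le> inverse (fact n) *\<^sub>R \<bar>x\<bar> ^ n" for n
  proof -
    have "(fact n :: real) \<le> fact (2 * n + 1)"
      by (intro fact_mono) simp
    then have "\<bar>x\<bar> ^ n / fact (2 * n + 1) \<le> \<bar>x\<bar> ^ n / fact n"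
      by (intro divide_left_mono mult_pos_pos) auto
    also have "\<bar>x\<bar> ^ n / fact (2 * n + 1) = norm (x ^ n / fact (2 * n + 1))"
      by (simp only: real_norm_def abs_divide power_abs abs_of_nonneg[OF fact_ge_zero])
    also have "\<bar>x\<bar> ^ n / fact n = inverse (fact n) *\<^sub>R \<bar>x\<bar> ^ n"
      by (simp add: divide_inverse mult.commute)
    finally show ?thesis .
  qed
  ultimately have "summable (\<lambda>n. x ^ n / fact (2 * n + 1))"
    by (rule summable_comparison_test')
  then show ?thesis
    unfolding sinhc_sqrt_def by (rule summable_sums)
qed

lemma sinhc_sqrt_minus_square: "y * sinhc_sqrt (- (y\<^sup>2)) = sin y"
proof -
  have "(\<lambda>n. y * ((- (y\<^sup>2)) ^ n / fact (2 * n + 1))) sums (y * sinhc_sqrt (- (y\<^sup>2)))"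
    by (intro sums_mult sinhc_sqrt_sums)
  moreover have "y * ((- (y\<^sup>2)) ^ n / fact (2 * n + 1)) = (- 1) ^ n / fact (2 * n + 1) * y ^ (2 * n + 1)" for n
    by (simp add: power_minus[of "y\<^sup>2"] power_mult)
  ultimately have "(\<lambda>n. (- 1) ^ n / fact (2 * n + 1) * y ^ (2 * n + 1)) sums (y * sinhc_sqrt (- (y\<^sup>2)))"
    by (simp only:)
  then show ?thesis
    using sin_paired by (rule sums_unique2)
qed

lemma sinhc_sqrt_square: "y * sinhc_sqrt (y\<^sup>2) = sinh y"
proof -
  have "(\<lambda>n. \<Sum>k = n * 2..<n * 2 + 2. if even k then 0 else y ^ k /\<^sub>R fact k) sums sinh y"
    by (rule sinh_converges[THEN sums_group]) simp
  moreover have "(\<Sum>k = n * 2..<n * 2 + 2. if even k then 0 else y ^ k /\<^sub>R fact k)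
      = y * ((y\<^sup>2) ^ n / fact (2 * n + 1))" for n
  proof -
    have "(y\<^sup>2) ^ n = y ^ (2 * n)" by (simp only: power_mult)
    then show ?thesis by (simp add: divide_inverse mult_ac)
  qed
  ultimately have "(\<lambda>n. y * ((y\<^sup>2) ^ n / fact (2 * n + 1))) sums sinh y"
    by simp
  moreover have "(\<lambda>n. y * ((y\<^sup>2) ^ n / fact (2 * n + 1))) sums (y * sinhc_sqrt (y\<^sup>2))"
    by (intro sums_mult sinhc_sqrt_sums)
  ultimately show ?thesis
    by (rule sums_unique2[symmetric])
qed

lemma sinhc_sqrt_0 [simp]: "sinhc_sqrt 0 = 1"
proof -
  have "(\<lambda>n. (0::real) ^ n / fact (2 * n + 1)) sums (\<Sum>n\<in>{0}. (0::real) ^ n / fact (2 * n + 1))"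
    by (intro sums_finite) auto
  with sinhc_sqrt_sums[of 0] show ?thesis
    by (auto dest: sums_unique2)
qed

text \<open>On the nonnegative axis every term of the series is increasing, and the term of degree one
  alone contributes the slope \<open>1 / 6\<close>.\<close>

lemma sinhc_sqrt_diff_ge:
  assumes "0 \<le> y" "y \<le> x"
  shows "sinhc_sqrt x - sinhc_sqrt y \<ge> (x - y) / 6"
proof -
  have s: "(\<lambda>n. x ^ n / fact (2 * n + 1) - y ^ n / fact (2 * n + 1)) sums (sinhc_sqrt x - sinhc_sqrt y)"
    by (intro sums_diff sinhc_sqrt_sums)
  have "(\<Sum>n\<in>{1}. x ^ n / fact (2 * n + 1) - y ^ n / fact (2 * n + 1)) \<le> sinhc_sqrt x - sinhc_sqrt y"
    unfolding sums_unique[OF s]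
    by (intro sum_le_suminf sums_summable[OF s]) (auto intro!: divide_right_mono power_mono assms)
  then show ?thesis
    by (simp add: fact_numeral diff_divide_distrib)
qed

lemma sin_ge_cubic:
  assumes "0 \<le> (x::real)"
  shows "x - x ^ 3 / 6 \<le> sin x"
proof -
  have "(\<lambda>x. sin x - x + x ^ 3 / 6) 0 \<le> (\<lambda>x::real. sin x - x + x ^ 3 / 6) x"
  proof (rule DERIV_nonneg_imp_nondecreasing[OF assms])
    fix t :: real
    have "1 - cos t = 2 * (sin (t / 2))\<^sup>2"
      using cos_double_sin[of "t / 2"] by simp
    also have "\<dots> \<le> 2 * (t / 2)\<^sup>2"
      using abs_sin_x_le_abs_x[of "t / 2"] by (simp only: abs_le_square_iff mult_le_cancel_left_pos zero_less_numeral)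
    finally have "0 \<le> cos t - 1 + t\<^sup>2 / 2"
      by (simp add: power_divide)
    then show "\<exists>y. ((\<lambda>x. sin x - x + x ^ 3 / 6) has_real_derivative y) (at t) \<and> 0 \<le> y"
      by (intro exI[of _ "cos t - 1 + t\<^sup>2 / 2"]) (auto intro!: derivative_eq_intros)
  qed
  then show ?thesis by simp
qed

lemma sin_minus_x_cos_le:
  assumes "0 \<le> (x::real)"
  shows "sin x - x * cos x \<le> x ^ 3 / 3"
proof -
  have "(\<lambda>x. x * cos x - sin x + x ^ 3 / 3) 0 \<le> (\<lambda>x::real. x * cos x - sin x + x ^ 3 / 3) x"
  proof (rule DERIV_nonneg_imp_nondecreasing[OF assms])
    fix t :: real
    assume "0 \<le> t"
    then have "0 \<le> t * (t - sin t)"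
      by (intro mult_nonneg_nonneg) (simp_all add: sin_x_le_x)
    then show "\<exists>y. ((\<lambda>x. x * cos x - sin x + x ^ 3 / 3) has_real_derivative y) (at t) \<and> 0 \<le> y"
      by (intro exI[of _ "t * (t - sin t)"])
         (auto intro!: derivative_eq_intros simp: power2_eq_square algebra_simps)
  qed
  then show ?thesis by simp
qed

text \<open>On the negative axis the slope is at most \<open>1 / 6\<close>, its value at the origin: in the variable
  \<open>t = sqrt u\<close> the function \<open>sin t / t + t\<^sup>2 / 6\<close> increases, because the numerator of its derivative is
  nonnegative by the preceding lemma. The quotient is not differentiable at \<open>t = 0\<close> as it stands,
  so \<open>u = 0\<close> is treated through the cubic lower bound for the sine.\<close>

lemma sinhc_sqrt_uminus_diff_le:
  assumes "0 \<le> u" "u \<le> v"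
  shows "sinhc_sqrt (- u) - sinhc_sqrt (- v) \<le> (v - u) / 6"
proof -
  define x y where "x = sqrt u" and "y = sqrt v"
  have xy: "0 \<le> x" "x \<le> y" "u = x\<^sup>2" "v = y\<^sup>2"
    using assms by (auto simp: x_def y_def)
  have F: "sinhc_sqrt (- (t\<^sup>2)) = sin t / t" if "t \<noteq> 0" for t
    using sinhc_sqrt_minus_square[of t] that by (simp add: field_simps)
  show ?thesis
  proof (cases "x = 0")
    case True
    show ?thesis
    proof (cases "y = 0")
      case False
      have "1 - y\<^sup>2 / 6 \<le> sin y / y"
        using sin_ge_cubic[of y] xy False by (simp add: field_simps power2_eq_square power3_eq_cube)
      with False True show ?thesis
        by (simp add: xy F)
    qed (use xy in simp)
  next
    case False
    have "(\<lambda>t. sin t / t + t\<^sup>2 / 6) x \<le> (\<lambda>t. sin t / t + t\<^sup>2 / 6) y"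
    proof (rule DERIV_nonneg_imp_nondecreasing[OF xy(2)])
      fix t assume "x \<le> t"
      with False xy have t: "t > 0" by simp
      have "((\<lambda>t. sin t / t + t\<^sup>2 / 6) has_real_derivative (t * cos t - sin t + t ^ 3 / 3) / t\<^sup>2) (at t)"
        using t by (auto intro!: derivative_eq_intros simp: field_simps power2_eq_square power3_eq_cube)
      moreover have "0 \<le> (t * cos t - sin t + t ^ 3 / 3) / t\<^sup>2"
        using sin_minus_x_cos_le[of t] t by (intro divide_nonneg_pos) auto
      ultimately show "\<exists>z. ((\<lambda>t. sin t / t + t\<^sup>2 / 6) has_real_derivative z) (at t) \<and> 0 \<le> z"
        by blast
    qed
    moreover have "y \<noteq> 0" using False xy by simp
    ultimately show ?thesis
      using False by (simp add: xy F diff_divide_distrib)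
  qed
qed

text \<open>The decay of the transform beyond the shape parameter. With \<open>y\<^sup>2 = w\<^sup>2 - \<beta>\<^sup>2\<close> the difference is
  \<open>sin y / y - sin w / w\<close>, and multiplying by \<open>w\<^sup>2 = y\<^sup>2 + \<beta>\<^sup>2\<close> turns it into
  \<open>\<beta>\<^sup>2 * (sin y / y) + (y * sin y - w * sin w)\<close>. Write \<open>d = w - y\<close> and \<open>s = w + y\<close>, so that
  \<open>d * s = \<beta>\<^sup>2\<close>. The last bracket is at most \<open>s = \<beta>\<^sup>2 / d\<close> trivially, and at most \<open>d + \<beta>\<^sup>2 / 2\<close> by
  integrating the derivative of \<open>t * sin t\<close>. The first estimate is good when \<open>d\<close> is large; when \<open>d\<close>
  is small, then \<open>y\<close> is large and \<open>sin y / y\<close> is small. The factor \<open>6 / 5\<close> is chosen so that the sum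
  over all aliases, \<open>6 / 5 * (pi\<^sup>2 / 3)\<close>, stays below \<open>4\<close>.\<close>

lemma sinhc_sqrt_diff_decay:
  assumes "2 * pi \<le> \<beta>" "\<beta> \<le> w"
  shows "\<bar>sinhc_sqrt (\<beta>\<^sup>2 - w\<^sup>2) - sinhc_sqrt (- (w\<^sup>2))\<bar> \<le> 6 / 5 * (\<beta> / w)\<^sup>2"
proof -
  have \<beta>_ge: "6.27 \<le> \<beta>"
    using assms(1) pi_approx(1) by simp
  define y where "y = sqrt (w\<^sup>2 - \<beta>\<^sup>2)"
  have y2: "y\<^sup>2 = w\<^sup>2 - \<beta>\<^sup>2" and y0: "0 \<le> y"
    using assms \<beta>_ge by (auto simp: y_def power_mono)
  have w0: "w > 0" using assms \<beta>_ge by simp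
  have bb: "39 < \<beta>\<^sup>2"
    using power_mono[OF \<beta>_ge, of 2] by (simp add: power2_eq_square)
  then have yw: "y < w"
    using w0 y2 by (intro power2_less_imp_less[of y w]) auto
  define d where "d = w - y"
  define s where "s = w + y"
  have ds: "d * s = \<beta>\<^sup>2" "0 < d" "0 < s" "w = (s + d) / 2" "y = (s - d) / 2"
    using y2 yw y0 w0 by (auto simp: d_def s_def power2_eq_square algebra_simps)
  define F where "F = sinhc_sqrt (- (y\<^sup>2))"
  have Fy: "y * F = sin y"
    by (simp add: F_def sinhc_sqrt_minus_square)
  have Fw: "w * sinhc_sqrt (- (w\<^sup>2)) = sin w"
    by (rule sinhc_sqrt_minus_square)
  have eq: "w\<^sup>2 * (sinhc_sqrt (\<beta>\<^sup>2 - w\<^sup>2) - sinhc_sqrt (- (w\<^sup>2))) = \<beta>\<^sup>2 * F + (y * sin y - w * sin w)"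
  proof -
    have "sinhc_sqrt (\<beta>\<^sup>2 - w\<^sup>2) = F" by (simp add: F_def y2)
    moreover have "w\<^sup>2 * sinhc_sqrt (- (w\<^sup>2)) = w * sin w"
      using Fw by (simp add: power2_eq_square)
    moreover have "w\<^sup>2 * F = \<beta>\<^sup>2 * F + y * sin y"
      using arg_cong[OF y2, of "\<lambda>x. x * F"] by (simp add: power2_eq_square algebra_simps flip: Fy)
    ultimately show ?thesis by (simp add: algebra_simps)
  qed
  have F1: "\<bar>F\<bar> \<le> 1"
  proof (cases "y = 0")
    case False
    then show ?thesis
      using abs_sin_x_le_abs_x[of y] by (simp flip: Fy add: abs_mult)
  qed (simp add: F_def)
  have Finv: "\<bar>F\<bar> \<le> 1 / Y" if "0 < Y" "Y \<le> y" for Y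
  proof -
    have "Y * \<bar>F\<bar> \<le> y * \<bar>F\<bar>" using that by (intro mult_right_mono) auto
    also have "\<dots> \<le> 1"
      using abs_sin_le_one[of y] y0 by (simp flip: Fy add: abs_mult)
    finally show ?thesis using that by (simp add: field_simps)
  qed
  have near: "\<bar>y * sin y - w * sin w\<bar> \<le> d + \<beta>\<^sup>2 / 2"
  proof -
    \<comment> \<open>The derivative of \<open>t * sin t\<close> is bounded by \<open>1 + t\<close>, the derivative of \<open>t + t\<^sup>2 / 2\<close>.\<close>
    have "(\<lambda>t. t\<^sup>2 / 2 + t + t * sin t) y \<le> (\<lambda>t. t\<^sup>2 / 2 + t + t * sin t) w"
    proof (rule DERIV_nonneg_imp_nondecreasing[OF less_imp_le[OF yw]])
      fix t assume "y \<le> t"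
      with y0 have "t * (- 1) \<le> t * cos t" by (intro mult_left_mono) auto
      then have "0 \<le> t + 1 + (sin t + t * cos t)"
        using sin_ge_minus_one[of t] by linarith
      then show "\<exists>z. ((\<lambda>t. t\<^sup>2 / 2 + t + t * sin t) has_real_derivative z) (at t) \<and> 0 \<le> z"
        by (intro exI[of _ "t + 1 + (sin t + t * cos t)"]) (auto intro!: derivative_eq_intros)
    qed
    moreover have "(\<lambda>t. t\<^sup>2 / 2 + t - t * sin t) y \<le> (\<lambda>t. t\<^sup>2 / 2 + t - t * sin t) w"
    proof (rule DERIV_nonneg_imp_nondecreasing[OF less_imp_le[OF yw]])
      fix t assume "y \<le> t"
      with y0 have "t * cos t \<le> t * 1" by (intro mult_left_mono) auto
      then have "0 \<le> t + 1 - (sin t + t * cos t)"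
        using sin_le_one[of t] by linarith
      then show "\<exists>z. ((\<lambda>t. t\<^sup>2 / 2 + t - t * sin t) has_real_derivative z) (at t) \<and> 0 \<le> z"
        by (intro exI[of _ "t + 1 - (sin t + t * cos t)"]) (auto intro!: derivative_eq_intros)
    qed
    moreover have "w\<^sup>2 / 2 - y\<^sup>2 / 2 = \<beta>\<^sup>2 / 2"
      using y2 by linarith
    ultimately show ?thesis
      unfolding d_def abs_le_iff by linarith
  qed
  have far: "\<bar>y * sin y - w * sin w\<bar> \<le> s"
  proof -
    have "\<bar>y * sin y\<bar> \<le> y * 1" "\<bar>w * sin w\<bar> \<le> w * 1"
      unfolding abs_mult using y0 w0 by (auto intro!: mult_mono abs_sin_le_one simp del: mult_1_right)
    then show ?thesis by (simp add: s_def abs_le_iff)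
  qed
  have "\<bar>\<beta>\<^sup>2 * F + (y * sin y - w * sin w)\<bar> \<le> 6 / 5 * \<beta>\<^sup>2"
  proof -
    have tri: "\<bar>\<beta>\<^sup>2 * F + (y * sin y - w * sin w)\<bar> \<le> \<beta>\<^sup>2 * \<bar>F\<bar> + \<bar>y * sin y - w * sin w\<bar>"
      by (rule order.trans[OF abs_triangle_ineq]) (simp add: abs_mult)
    have y_ge: "(39 / D - D) / 2 \<le> y" if "0 < D" "d \<le> D" for D
    proof -
      have "39 \<le> D * s"
        using mult_right_mono[OF that(2), of s] ds bb by linarith
      then have "39 / D \<le> s" using that by (simp add: field_simps)
      then show ?thesis using ds that by simp
    qed
    \<comment> \<open>For \<open>d \<le> 4\<close> and \<open>d \<le> 5\<close> this gives \<open>y \<ge> 2.875\<close> and \<open>y \<ge> 1.4\<close>; beyond, \<open>\<bar>sin y / y\<bar> \<le> 1\<close> is enough.\<close>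
    consider "d \<le> 4" | "4 \<le> d" "d \<le> 5" | "5 \<le> d" by linarith
    then show ?thesis
    proof cases
      case 1
      have "\<beta>\<^sup>2 * \<bar>F\<bar> \<le> \<beta>\<^sup>2 * (1 / (2875 / 1000))"
        using y_ge[OF _ 1] by (intro mult_left_mono Finv) auto
      with tri near 1 bb show ?thesis by simp
    next
      case 2
      have "\<beta>\<^sup>2 * \<bar>F\<bar> \<le> \<beta>\<^sup>2 * (1 / (7 / 5))"
        using y_ge[OF _ 2(2)] by (intro mult_left_mono Finv) auto
      moreover have "4 * s \<le> \<beta>\<^sup>2"
        using mult_right_mono[OF 2(1), of s] ds by linarith
      ultimately show ?thesis using tri far bb by simp
    next
      case 3
      have "\<beta>\<^sup>2 * \<bar>F\<bar> \<le> \<beta>\<^sup>2 * 1"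
        by (intro mult_left_mono F1) auto
      moreover have "5 * s \<le> \<beta>\<^sup>2"
        using mult_right_mono[OF 3, of s] ds by linarith
      ultimately show ?thesis using tri far by simp
    qed
  qed
  then have "w\<^sup>2 * \<bar>sinhc_sqrt (\<beta>\<^sup>2 - w\<^sup>2) - sinhc_sqrt (- (w\<^sup>2))\<bar> \<le> 6 / 5 * \<beta>\<^sup>2"
    using arg_cong[OF eq, of abs] by (simp add: abs_mult)
  then show ?thesis
    using w0 by (simp add: field_simps)
qed

text \<open>The transform decreases in \<open>w\<^sup>2\<close> below the shape parameter, since the slope of \<^const>\<open>sinhc_sqrt\<close>
  is at least \<open>1 / 6\<close> to the right of the origin and at most \<open>1 / 6\<close> to the left. It is therefore
  smallest at \<open>w = w0\<close>, where \<open>sin w0\<close> is replaced by \<open>1\<close>.\<close>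

lemma sinhc_sqrt_diff_lower_bound:
  assumes "\<bar>w\<bar> \<le> w0" "0 < w0" "0 < S" "S\<^sup>2 = \<beta>\<^sup>2 - w0\<^sup>2"
  shows "sinh S / S - 1 / w0 \<le> sinhc_sqrt (\<beta>\<^sup>2 - w\<^sup>2) - sinhc_sqrt (- (w\<^sup>2))"
proof -
  have w2: "w\<^sup>2 \<le> w0\<^sup>2"
    using assms by (simp add: abs_le_square_iff[symmetric])
  have "sinhc_sqrt (\<beta>\<^sup>2 - w\<^sup>2) - sinhc_sqrt (S\<^sup>2) \<ge> (w0\<^sup>2 - w\<^sup>2) / 6"
    using sinhc_sqrt_diff_ge[of "S\<^sup>2" "\<beta>\<^sup>2 - w\<^sup>2"] zero_le_power2[of S] assms(4) w2
    by (simp del: zero_le_power2)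
  moreover have "sinhc_sqrt (- (w\<^sup>2)) - sinhc_sqrt (- (w0\<^sup>2)) \<le> (w0\<^sup>2 - w\<^sup>2) / 6"
    using w2 by (intro sinhc_sqrt_uminus_diff_le) auto
  moreover have "sinhc_sqrt (S\<^sup>2) = sinh S / S"
    using sinhc_sqrt_square[of S] assms(3) by (simp add: field_simps)
  moreover have "sinhc_sqrt (- (w0\<^sup>2)) \<le> 1 / w0"
    using sinhc_sqrt_minus_square[of w0] sin_le_one[of w0] assms by (simp add: field_simps)
  ultimately show ?thesis by linarith
qed

section \<open>The Fourier transform of the window\<close>

lemma bessel_I0_sums: "(\<lambda>k. ((x / 2)\<^sup>2) ^ k / (fact k)\<^sup>2) sums bessel_I0 x"
proof -
  have "summable (\<lambda>k. inverse (fact k) *\<^sub>R ((x / 2)\<^sup>2) ^ k)"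
    by (rule summable_exp_generic)
  moreover have "norm (((x / 2)\<^sup>2) ^ k / (fact k)\<^sup>2) \<le> inverse (fact k) *\<^sub>R ((x / 2)\<^sup>2) ^ k" for k
  proof -
    have "(fact k :: real) * 1 \<le> fact k * fact k"
      by (intro mult_left_mono) (auto simp: fact_ge_1)
    then have "((x / 2)\<^sup>2) ^ k / (fact k)\<^sup>2 \<le> ((x / 2)\<^sup>2) ^ k / fact k"
      by (intro divide_left_mono mult_pos_pos) (auto simp: power2_eq_square)
    also have "\<dots> = inverse (fact k) *\<^sub>R ((x / 2)\<^sup>2) ^ k"
      by (simp only: divide_inverse mult.commute real_scaleR_def)
    finally show ?thesis by simp
  qed
  ultimately have "summable (\<lambda>k. ((x / 2)\<^sup>2) ^ k / (fact k)\<^sup>2)"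
    by (rule summable_comparison_test')
  then show ?thesis
    unfolding bessel_I0_def power_mult by (simp add: summable_sums)
qed

lemma bessel_I0_0 [simp]: "bessel_I0 0 = 1"
proof -
  have "(\<lambda>k. ((0 / 2 :: real)\<^sup>2) ^ k / (fact k)\<^sup>2) sums (\<Sum>k\<in>{0}. ((0 / 2 :: real)\<^sup>2) ^ k / (fact k)\<^sup>2)"
    by (intro sums_finite) auto
  with bessel_I0_sums[of 0] show ?thesis
    by (auto dest: sums_unique2)
qed

lemma bessel_I0_gt_1:
  assumes "x \<noteq> 0"
  shows "1 < bessel_I0 x"
proof -
  have "(\<Sum>k<2. ((x / 2)\<^sup>2) ^ k / (fact k)\<^sup>2) \<le> bessel_I0 x"
    unfolding sums_unique[OF bessel_I0_sums]
    by (intro sum_le_suminf sums_summable[OF bessel_I0_sums]) auto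
  moreover have "0 < (x / 2)\<^sup>2" using assms by simp
  ultimately show ?thesis
    by (simp add: numeral_2_eq_2)
qed

text \<open>A Beta integral, obtained from \<open>(1 - t\<^sup>2) ^ Suc k = (1 - t\<^sup>2) ^ k - (1 - t\<^sup>2) ^ k * t\<^sup>2\<close> by induction
  on \<open>k\<close>. The closed form with factorials fits the binomial theorem in the next computation.\<close>

lemma LBINT_even_moment:
  "(LINT t|lborel. indicator {-1..1::real} t * ((1 - t\<^sup>2) ^ k * t ^ (2 * j)))
    = 2 * 4 ^ k * fact k * fact (2 * j) * fact (k + j) / (fact j * fact (2 * (k + j) + 1) :: real)"
proof (induction k arbitrary: j)
  case 0
  have "(LINT t|lborel. t ^ (2 * j) * indicator {-1..1} t) = (2::real) / (2 * j + 1)"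
    by (subst integral_power) auto
  then have "(LINT t|lborel. indicator {-1..1} t * t ^ (2 * j)) = (2::real) / (2 * j + 1)"
    by (simp only: mult.commute)
  moreover have "(fact (2 * (0 + j) + 1) :: real) = (2 * real j + 1) * fact (2 * j)"
    by (simp add: algebra_simps)
  ultimately show ?case
    by (simp del: fact_Suc One_nat_def add_Suc_right)
next
  case (Suc k)
  have int: "integrable lborel (\<lambda>t. indicator {-1..1::real} t * ((1 - t\<^sup>2) ^ k * t ^ (2 * i)))" for i
    using borel_integrable_atLeastAtMost'[of "-1" 1 "\<lambda>t::real. (1 - t\<^sup>2) ^ k * t ^ (2 * i)"]
    by (simp add: set_integrable_def continuous_intros)
  have "(LINT t|lborel. indicator {-1..1::real} t * ((1 - t\<^sup>2) ^ Suc k * t ^ (2 * j)))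
     = (LINT t|lborel. indicator {-1..1::real} t * ((1 - t\<^sup>2) ^ k * t ^ (2 * j)) -
          indicator {-1..1::real} t * ((1 - t\<^sup>2) ^ k * t ^ (2 * Suc j)))"
    by (intro Bochner_Integration.integral_cong refl)
       (simp add: algebra_simps power2_eq_square)
  also have "\<dots> = 2 * 4 ^ k * fact k * fact (2 * j) * fact (k + j) / (fact j * fact (2 * (k + j) + 1))
      - 2 * 4 ^ k * fact k * fact (2 * Suc j) * fact (k + Suc j) / (fact (Suc j) * fact (2 * (k + Suc j) + 1))"
    by (simp only: Bochner_Integration.integral_diff[OF int int] Suc)
  also have "\<dots> = 2 * 4 ^ Suc k * fact (Suc k) * fact (2 * j) * fact (Suc k + j) / (fact j * fact (2 * (Suc k + j) + 1))"
  proof -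
    \<comment> \<open>The two moments are \<open>K\<close> and \<open>K * (2 * j + 1) / (2 * n + 3)\<close>; their difference is the new moment.\<close>
    define n where "n = real k + real j"
    define K where "K = 2 * 4 ^ k * fact k * fact (2 * j) * fact (k + j) / (fact j * fact (2 * (k + j) + 1) :: real)"
    have f: "fact (2 * Suc j) = (2 * real j + 2) * (2 * real j + 1) * fact (2 * j)"
        "fact (k + Suc j) = (n + 1) * fact (k + j)"
        "fact (Suc k + j) = (n + 1) * fact (k + j)"
        "fact (Suc j) = (real j + 1) * fact j"
        "fact (2 * (k + Suc j) + 1) = (2 * n + 3) * (2 * n + 2) * fact (2 * (k + j) + 1)"
        "fact (2 * (Suc k + j) + 1) = (2 * n + 3) * (2 * n + 2) * fact (2 * (k + j) + 1)"
        "fact (Suc k) = (real k + 1) * fact k"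
      by (simp_all add: n_def algebra_simps)
    have n: "n + 1 \<noteq> 0" "2 * n + 3 \<noteq> 0" "2 * n + 2 \<noteq> 0" "real j + 1 \<noteq> 0"
      by (simp_all add: n_def add_eq_0_iff_both_eq_0)
    have "2 * 4 ^ k * fact k * fact (2 * Suc j) * fact (k + Suc j) / (fact (Suc j) * fact (2 * (k + Suc j) + 1))
        = K * ((2 * real j + 2) * (2 * real j + 1) * (n + 1) / ((real j + 1) * ((2 * n + 3) * (2 * n + 2))))"
      unfolding f K_def
      by (simp only: times_divide_eq_left times_divide_eq_right divide_divide_eq_left mult_ac power_Suc)
    also have "\<dots> = K * ((2 * real j + 1) / (2 * n + 3))"
      using n by (simp add: divide_simps) (simp add: algebra_simps)
    finally have 1: "2 * 4 ^ k * fact k * fact (2 * Suc j) * fact (k + Suc j) / (fact (Suc j) * fact (2 * (k + Suc j) + 1))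
        = K * ((2 * real j + 1) / (2 * n + 3))" .
    have "2 * 4 ^ Suc k * fact (Suc k) * fact (2 * j) * fact (Suc k + j) / (fact j * fact (2 * (Suc k + j) + 1))
        = K * (4 * (real k + 1) * (n + 1) / ((2 * n + 3) * (2 * n + 2)))"
      unfolding f K_def
      by (simp only: times_divide_eq_left times_divide_eq_right divide_divide_eq_left mult_ac power_Suc)
    also have "\<dots> = K * (1 - (2 * real j + 1) / (2 * n + 3))"
      using n by (simp add: divide_simps) (simp add: n_def algebra_simps)
    finally show ?thesis
      unfolding 1 K_def[symmetric] by (simp add: algebra_simps)
  qed
  finally show ?case .
qed

lemma has_bochner_integral_even_moment:
  "has_bochner_integral lborel (\<lambda>t. indicator {-1..1::real} t * ((1 - t\<^sup>2) ^ k * t ^ (2 * j)))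
    (2 * 4 ^ k * fact k * fact (2 * j) * fact (k + j) / (fact j * fact (2 * (k + j) + 1)))"
  using borel_integrable_atLeastAtMost'[of "-1" 1 "\<lambda>t::real. (1 - t\<^sup>2) ^ k * t ^ (2 * j)"] LBINT_even_moment[of k j]
  by (simp add: has_bochner_integral_iff set_integrable_def continuous_intros)

text \<open>The key integral. Multiply the series of \<^const>\<open>bessel_I0\<close> and of the cosine as a Cauchy
  product: the square root disappears, and the part that is homogeneous of degree \<open>2 * n\<close> in
  \<open>(\<beta>, w)\<close> is a polynomial in \<open>t\<close>. By the moments above its integral is
  \<open>2 / fact (2 * n + 1)\<close> times the binomial expansion of \<open>(\<beta>\<^sup>2 - w\<^sup>2) ^ n\<close>. The \<open>n\<close>-th part is bounded
  on \<open>{-1..1}\<close> by the coefficient \<open>C n\<close> of a convergent Cauchy product, which allows integration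
  term by term. The case \<open>\<beta> = 0\<close> is the integral of \<open>cos (w * t)\<close> alone.\<close>

lemma has_bochner_integral_bessel_cos:
  "has_bochner_integral lborel
     (\<lambda>t. indicator {-1..1} t * (bessel_I0 (\<beta> * sqrt (1 - t\<^sup>2)) * cos (w * t)))
     (2 * sinhc_sqrt (\<beta>\<^sup>2 - w\<^sup>2))"
proof -
  define a where "a t k = ((\<beta> / 2)\<^sup>2 * (1 - t\<^sup>2)) ^ k / (fact k)\<^sup>2" for t k
  define c where "c t j = (- 1) ^ j / fact (2 * j) * (w * t) ^ (2 * j)" for t j
  define f where "f n t = indicator {-1..1} t * (\<Sum>k\<le>n. a t k * c t (n - k))" for n t
  define C where "C n = (\<Sum>k\<le>n. ((\<beta> / 2)\<^sup>2) ^ k / (fact k)\<^sup>2 * (w ^ (2 * (n - k)) / fact (2 * (n - k))))" for n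
  have a_sums: "a t sums bessel_I0 (\<beta> * sqrt (1 - t\<^sup>2))" if "t \<in> {-1..1}" for t
  proof -
    have "0 \<le> 1 - t\<^sup>2" using that by (simp add: abs_square_le_1 abs_le_iff)
    then have "(\<beta> * sqrt (1 - t\<^sup>2) / 2)\<^sup>2 = (\<beta> / 2)\<^sup>2 * (1 - t\<^sup>2)"
      by (simp add: power_mult_distrib power_divide)
    then show ?thesis
      using bessel_I0_sums[of "\<beta> * sqrt (1 - t\<^sup>2)"] by (simp add: a_def[abs_def])
  qed
  have c_sums: "c t sums cos (w * t)" for t
    unfolding c_def[abs_def] by (rule cos_paired)
  have a_norm: "norm (a t k) \<le> ((\<beta> / 2)\<^sup>2) ^ k / (fact k)\<^sup>2" if "t \<in> {-1..1}" for t k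
  proof -
    have "0 \<le> 1 - t\<^sup>2" using that by (simp add: abs_square_le_1 abs_le_iff)
    then have "(1 - t\<^sup>2) ^ k \<le> 1" "0 \<le> (1 - t\<^sup>2) ^ k"
      by (auto intro!: power_le_one)
    then have "((\<beta> / 2)\<^sup>2) ^ k * (1 - t\<^sup>2) ^ k \<le> ((\<beta> / 2)\<^sup>2) ^ k * 1"
      by (intro mult_left_mono) auto
    then show ?thesis
      using \<open>0 \<le> (1 - t\<^sup>2) ^ k\<close> unfolding a_def power_mult_distrib[of _ "1 - t\<^sup>2"]
      by (simp add: abs_mult divide_right_mono)
  qed
  have c_norm: "norm (c t j) \<le> w ^ (2 * j) / fact (2 * j)" if "t \<in> {-1..1}" for t j
  proof -
    have "t ^ (2 * j) \<le> 1"
      using that by (simp add: power_mult power_le_one abs_square_le_1 abs_le_iff)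
    then have "w ^ (2 * j) * t ^ (2 * j) \<le> w ^ (2 * j) * 1"
      by (intro mult_left_mono) auto
    then show ?thesis
      by (simp add: c_def abs_mult power_mult_distrib divide_right_mono)
  qed
  have sum_a: "summable (\<lambda>k. ((\<beta> / 2)\<^sup>2) ^ k / (fact k)\<^sup>2)"
    using bessel_I0_sums[of \<beta>] by (rule sums_summable)
  have sum_c: "summable (\<lambda>j. w ^ (2 * j) / fact (2 * j))"
  proof -
    have "summable (\<lambda>j. inverse (fact j) *\<^sub>R (w\<^sup>2) ^ j)"
      by (rule summable_exp_generic)
    moreover have "norm (w ^ (2 * j) / fact (2 * j)) \<le> inverse (fact j) *\<^sub>R (w\<^sup>2) ^ j" for j
    proof -
      have "(fact j :: real) \<le> fact (2 * j)"
        by (intro fact_mono) simp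
      then have "(w\<^sup>2) ^ j / fact (2 * j) \<le> (w\<^sup>2) ^ j / fact j"
        by (intro divide_left_mono mult_pos_pos) auto
      also have "\<dots> = inverse (fact j) *\<^sub>R (w\<^sup>2) ^ j"
        by (simp only: divide_inverse mult.commute real_scaleR_def)
      finally show ?thesis by (simp add: power_mult)
    qed
    ultimately show ?thesis
      by (rule summable_comparison_test')
  qed
  have sum_C: "summable C"
    unfolding C_def using sum_a sum_c by (intro summable_Cauchy_product) (simp_all add: power_mult)
  have f_norm: "norm (f n t) \<le> indicator {-1..1} t * C n" for n t
  proof (cases "t \<in> {-1..1}")
    case True
    have "norm (\<Sum>k\<le>n. a t k * c t (n - k)) \<le> C n"
      unfolding C_def
      by (intro sum_norm_le) (auto simp only: norm_mult intro!: mult_mono a_norm c_norm True divide_nonneg_nonneg norm_ge_zero zero_le_power2 zero_le_power)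
    then show ?thesis using True by (simp add: f_def)
  qed (simp add: f_def)
  have f_sums: "(\<lambda>n. f n t) sums
      (indicator {-1..1} t * (bessel_I0 (\<beta> * sqrt (1 - t\<^sup>2)) * cos (w * t)))" for t
  proof (cases "t \<in> {-1..1}")
    case True
    have "(\<lambda>n. \<Sum>k\<le>n. a t k * c t (n - k)) sums ((\<Sum>k. a t k) * (\<Sum>k. c t k))"
    proof (rule Cauchy_product_sums)
      show "summable (\<lambda>k. norm (a t k))"
        by (rule summable_comparison_test'[OF sum_a, of 0]) (use a_norm[OF True] in simp)
      show "summable (\<lambda>j. norm (c t j))"
        by (rule summable_comparison_test'[OF sum_c, of 0]) (use c_norm[OF True] in simp)
    qed
    then show ?thesis
      using True a_sums[OF True] c_sums[of t] by (simp add: f_def sums_iff)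
  qed (simp add: f_def)
  have f_int: "has_bochner_integral lborel (f n) (2 * ((\<beta>\<^sup>2 - w\<^sup>2) ^ n / fact (2 * n + 1)))" for n
  proof -
    have f_eq: "f n = (\<lambda>t. \<Sum>k\<le>n. (\<beta> / 2) ^ (2 * k) / (fact k)\<^sup>2 * ((- 1) ^ (n - k) * w ^ (2 * (n - k)) / fact (2 * (n - k)))
        * (indicator {-1..1} t * ((1 - t\<^sup>2) ^ k * t ^ (2 * (n - k)))))"
    proof (rule ext)
      fix t
      show "f n t = (\<Sum>k\<le>n. (\<beta> / 2) ^ (2 * k) / (fact k)\<^sup>2 * ((- 1) ^ (n - k) * w ^ (2 * (n - k)) / fact (2 * (n - k)))
          * (indicator {-1..1} t * ((1 - t\<^sup>2) ^ k * t ^ (2 * (n - k)))))"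
        unfolding f_def sum_distrib_left
      proof (intro sum.cong refl)
        fix k
        show "indicator {-1..1} t * (a t k * c t (n - k))
          = (\<beta> / 2) ^ (2 * k) / (fact k)\<^sup>2 * ((- 1) ^ (n - k) * w ^ (2 * (n - k)) / fact (2 * (n - k)))
            * (indicator {-1..1} t * ((1 - t\<^sup>2) ^ k * t ^ (2 * (n - k))))"
          unfolding a_def c_def power_mult[of "\<beta> / 2"] power_mult_distrib[of "(\<beta> / 2)\<^sup>2"] power_mult_distrib[of w]
          by (simp only: times_divide_eq_left times_divide_eq_right mult_ac divide_divide_eq_left)
      qed
    qed
    have "has_bochner_integral lborel (f n) (\<Sum>k\<le>n. (\<beta> / 2) ^ (2 * k) / (fact k)\<^sup>2 * ((- 1) ^ (n - k) * w ^ (2 * (n - k)) / fact (2 * (n - k)))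
        * (2 * 4 ^ k * fact k * fact (2 * (n - k)) * fact (k + (n - k)) / (fact (n - k) * fact (2 * (k + (n - k)) + 1))))"
      unfolding f_eq by (intro has_bochner_integral_sum has_bochner_integral_mult_right has_bochner_integral_even_moment)
    also have "(\<Sum>k\<le>n. (\<beta> / 2) ^ (2 * k) / (fact k)\<^sup>2 * ((- 1) ^ (n - k) * w ^ (2 * (n - k)) / fact (2 * (n - k)))
        * (2 * 4 ^ k * fact k * fact (2 * (n - k)) * fact (k + (n - k)) / (fact (n - k) * fact (2 * (k + (n - k)) + 1))))
        = (\<Sum>k\<le>n. 2 / fact (2 * n + 1) * (real (n choose k) * (\<beta>\<^sup>2) ^ k * (- (w\<^sup>2)) ^ (n - k)))"
    proof (intro sum.cong refl)
      fix k assume "k \<in> {..n}"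
      then have k: "k \<le> n" by simp
      have 1: "(\<beta> / 2) ^ (2 * k) = (\<beta>\<^sup>2) ^ k / 4 ^ k"
        by (simp add: power_mult power_divide)
      have 2: "(- (w\<^sup>2)) ^ (n - k) = (- 1) ^ (n - k) * w ^ (2 * (n - k))"
        by (simp add: power_minus[of "w\<^sup>2"] power_mult)
      have 3: "k + (n - k) = n" using k by simp
      show "(\<beta> / 2) ^ (2 * k) / (fact k)\<^sup>2 * ((- 1) ^ (n - k) * w ^ (2 * (n - k)) / fact (2 * (n - k)))
        * (2 * 4 ^ k * fact k * fact (2 * (n - k)) * fact (k + (n - k)) / (fact (n - k) * fact (2 * (k + (n - k)) + 1)))
        = 2 / fact (2 * n + 1) * (real (n choose k) * (\<beta>\<^sup>2) ^ k * (- (w\<^sup>2)) ^ (n - k))"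
        unfolding 1 2 3 binomial_fact[OF k]
        by (simp add: power2_eq_square del: fact_Suc) (simp only: mult_ac)
    qed
    also have "\<dots> = 2 * ((\<beta>\<^sup>2 - w\<^sup>2) ^ n / fact (2 * n + 1))"
      using binomial_ring[of "\<beta>\<^sup>2" "- (w\<^sup>2)" n] by (simp add: sum_distrib_left[symmetric] sum_divide_distrib[symmetric] del: fact_Suc)
    finally show ?thesis .
  qed
  have int: "integrable lborel (f n)" for n
    using f_int by (rule integrable.intros)
  have int1: "integrable lborel (\<lambda>t. indicator {-1..1::real} t * C n)" for n
    by simp
  have AE: "AE t in lborel. summable (\<lambda>n. norm (f n t))"
  proof (rule AE_I2)
    fix t
    have "norm (norm (f n t)) \<le> C n" for n
      using f_norm[of n t] by (cases "t \<in> {-1..1}") (auto simp: f_def C_def intro!: sum_nonneg)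
    then show "summable (\<lambda>n. norm (f n t))"
      by (rule summable_comparison_test'[OF sum_C])
  qed
  have sum_int: "summable (\<lambda>n. LINT t|lborel. norm (f n t))"
  proof -
    have "norm (LINT t|lborel. norm (f n t)) \<le> 2 * C n" for n
    proof -
      have "(LINT t|lborel. norm (f n t)) \<le> (LINT t|lborel. indicator {-1..1::real} t * C n)"
        by (intro integral_mono f_norm int1 integrable_norm int)
      also have "\<dots> = 2 * C n" by simp
      finally show ?thesis by simp
    qed
    then show ?thesis
      by (rule summable_comparison_test'[OF summable_mult[OF sum_C, of 2]])
  qed
  have "(\<lambda>n. 2 * ((\<beta>\<^sup>2 - w\<^sup>2) ^ n / fact (2 * n + 1))) sums (LINT t|lborel. (\<Sum>n. f n t))"
    using sums_integral[OF int AE sum_int] f_int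
    by (simp add: has_bochner_integral_iff)
  moreover have "(\<lambda>n. 2 * ((\<beta>\<^sup>2 - w\<^sup>2) ^ n / fact (2 * n + 1))) sums (2 * sinhc_sqrt (\<beta>\<^sup>2 - w\<^sup>2))"
    by (intro sums_mult sinhc_sqrt_sums)
  ultimately have "(LINT t|lborel. (\<Sum>n. f n t)) = 2 * sinhc_sqrt (\<beta>\<^sup>2 - w\<^sup>2)"
    by (rule sums_unique2)
  moreover have "integrable lborel (\<lambda>t. \<Sum>n. f n t)"
    by (rule integrable_suminf[OF int AE sum_int])
  ultimately show ?thesis
    by (simp add: has_bochner_integral_iff sums_unique[OF f_sums, symmetric])
qed

text \<open>The closed interval can be used here because \<open>bessel_I0 0 = 1\<close> makes the formula vanish at the
  end points. This continuity is what the subtraction of \<open>1\<close> in the window achieves.\<close>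

lemma cKB_rescaled:
  assumes "0 < m" "0 < N1"
  shows "cKB m \<beta> N1 (real m / real N1 * t)
    = indicator {-1..1} t * (bessel_I0 (\<beta> * sqrt (1 - t\<^sup>2)) - 1) / (bessel_I0 \<beta> - 1)"
proof -
  have "real m / real N1 * t \<in> {- (real m / real N1) <..< real m / real N1} \<longleftrightarrow> t \<in> {-1<..<1}"
  proof -
    have "-1 < t \<longleftrightarrow> real m / real N1 * (-1) < real m / real N1 * t"
      and "t < 1 \<longleftrightarrow> real m / real N1 * t < real m / real N1 * 1"
      using assms by (simp_all only: mult_less_cancel_left_pos divide_pos_pos of_nat_0_less_iff)
    then show ?thesis by simp
  qed
  moreover have "real N1 * (real m / real N1 * t) / real m = t"
    using assms by (simp add: field_simps)
  moreover have "t = 1 \<or> t = -1" if "t \<in> {-1..1}" "t \<notin> {-1<..<1}"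
    using that by auto
  ultimately show ?thesis
    unfolding cKB_def by (auto split: split_indicator)
qed

text \<open>After rescaling to \<open>{-1..1}\<close>, evenness of the window removes the sine part, and the cosine part
  is the difference of the key integral at \<open>\<beta>\<close> and at \<open>0\<close>.\<close>

lemma fourier_cKB:
  fixes v :: real
  assumes "0 < m" "0 < N1"
  defines "w \<equiv> 2 * pi * real m * v / real N1"
  shows "fourier (cKB m \<beta> N1) v = of_real (2 * real m / (real N1 * (bessel_I0 \<beta> - 1))
    * (sinhc_sqrt (\<beta>\<^sup>2 - w\<^sup>2) - sinhc_sqrt (- (w\<^sup>2))))"
proof -
  define g where "g t = indicator {-1..1} t * (bessel_I0 (\<beta> * sqrt (1 - t\<^sup>2)) - 1)" for t :: real
  define K where "K = bessel_I0 \<beta> - 1"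
  define c where "c = real m / real N1"
  have c: "c > 0" using assms by (simp add: c_def)
  have cos: "has_bochner_integral lborel (\<lambda>t. g t * cos (u * t))
      (2 * (sinhc_sqrt (\<beta>\<^sup>2 - u\<^sup>2) - sinhc_sqrt (- (u\<^sup>2))))" for u
    using has_bochner_integral_diff[OF has_bochner_integral_bessel_cos[of \<beta> u] has_bochner_integral_bessel_cos[of 0 u]]
    by (simp add: g_def algebra_simps)
  have g_int: "integrable lborel g"
    using integrable.intros[OF cos[of 0]] by simp
  have sin_int: "integrable lborel (\<lambda>t. g t * sin (w * t))"
    using borel_measurable_integrable[OF g_int]
    by (intro Bochner_Integration.integrable_bound[OF g_int])
       (auto simp: abs_mult intro!: mult_left_le)
  have sin_0: "(LINT t|lborel. g t * sin (w * t)) = 0"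
  proof -
    have "(LINT t|lborel. g t * sin (w * t)) = (LINT t|lborel. g (- t) * sin (w * - t))"
      using lborel_integral_real_affine[of "-1" "\<lambda>t. g t * sin (w * t)" 0] by simp
    also have "\<dots> = (LINT t|lborel. - (g t * sin (w * t)))"
      by (intro Bochner_Integration.integral_cong refl) (auto simp: g_def split: split_indicator)
    finally show ?thesis by simp
  qed
  have exp_eq: "exp (- 2 * of_real pi * \<i> * of_real v * of_real (c * t)) = of_real (cos (w * t)) - \<i> * of_real (sin (w * t))" for t
  proof -
    have "- 2 * of_real pi * \<i> * of_real v * of_real (c * t) = \<i> * complex_of_real (- (w * t))"
      by (simp add: w_def c_def)
    then show ?thesis
      by (simp only: cis_conv_exp[symmetric]) (simp add: complex_eq_iff)
  qed
  have "fourier (cKB m \<beta> N1) v = c *\<^sub>R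
      (LINT t|lborel. of_real (cKB m \<beta> N1 (c * t)) * exp (- 2 * of_real pi * \<i> * of_real v * of_real (c * t)))"
    unfolding fourier_def
    using lborel_integral_real_affine[of c "\<lambda>x. of_real (cKB m \<beta> N1 x) * exp (- 2 * of_real pi * \<i> * of_real v * of_real x)" 0] c
    by simp
  also have "(\<lambda>t. of_real (cKB m \<beta> N1 (c * t)) * exp (- 2 * of_real pi * \<i> * of_real v * of_real (c * t)))
    = (\<lambda>t. (complex_of_real (g t * cos (w * t)) - \<i> * of_real (g t * sin (w * t))) / of_real K)"
    unfolding exp_eq unfolding c_def cKB_rescaled[OF assms(1,2)] g_def[symmetric] K_def[symmetric]
    by (simp add: fun_eq_iff right_diff_distrib diff_divide_distrib mult_ac)
  also have "(LINT t|lborel. (complex_of_real (g t * cos (w * t)) - \<i> * of_real (g t * sin (w * t))) / of_real K)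
    = (of_real (LINT t|lborel. g t * cos (w * t)) - \<i> * of_real (LINT t|lborel. g t * sin (w * t))) / of_real K"
    using integrable.intros[OF cos[of w]] sin_int
    by (simp del: of_real_mult add: Bochner_Integration.integral_diff)
  also have "c *\<^sub>R \<dots> = of_real (2 * real m / (real N1 * K) * (sinhc_sqrt (\<beta>\<^sup>2 - w\<^sup>2) - sinhc_sqrt (- (w\<^sup>2))))"
    unfolding sin_0 using has_bochner_integral_integral_eq[OF cos[of w]]
    by (simp add: c_def scaleR_conv_of_real)
  finally show ?thesis
    by (simp only: K_def)
qed

section \<open>Summation over the aliases\<close>

lemma inverse_squares_has_sum_int:
  "((\<lambda>r. 1 / (of_int r)\<^sup>2) has_sum (pi\<^sup>2 / 3)) (UNIV - {0 :: int})"
proof -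
  have nat: "((\<lambda>n::nat. 1 / (real n + 1)\<^sup>2) has_sum (pi\<^sup>2 / 6)) UNIV"
    using inverse_squares_sums
    by (intro norm_summable_imp_has_sum) (auto dest: sums_summable simp: add.commute)
  have pos: "((\<lambda>r. 1 / (of_int r)\<^sup>2) has_sum (pi\<^sup>2 / 6)) {1 :: int..}"
  proof -
    have "bij_betw (\<lambda>n. int n + 1) UNIV {1..}"
      by (rule bij_betwI[where g = "\<lambda>r. nat (r - 1)"]) auto
    then show ?thesis
      using nat by (subst has_sum_reindex_bij_betw[symmetric]) auto
  qed
  have neg: "((\<lambda>r. 1 / (of_int r)\<^sup>2) has_sum (pi\<^sup>2 / 6)) {..-1 :: int}"
  proof -
    have "bij_betw uminus {1 :: int..} {..-1}"
      by (rule bij_betwI[where g = uminus]) auto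
    then show ?thesis
      using pos has_sum_reindex_bij_betw[of uminus "{1 :: int..}" "{..-1}" "\<lambda>r. 1 / (real_of_int r)\<^sup>2"] by simp
  qed
  from pos neg have "((\<lambda>r. 1 / (of_int r)\<^sup>2) has_sum (pi\<^sup>2 / 6 + pi\<^sup>2 / 6)) ({1 :: int..} \<union> {..-1})"
    by (intro has_sum_Un_disjoint) auto
  moreover have "{1 :: int..} \<union> {..-1} = UNIV - {0}" by auto
  ultimately show ?thesis by (simp add: field_simps)
qed

instance bcontfun :: (metric_space, banach) banach ..

lemma norm_scaled_exp_le: "norm (scaled_exp c k) \<le> cmod c"
  by (rule norm_bound) (simp add: apply_scaled_exp norm_mult norm_exp_eq_Re)

lemma finite_freqs [simp]: "finite (freqs N)"
  by (simp add: freqs_def)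

lemma freqs_nonempty:
  assumes "0 < N" "even N"
  shows "freqs N \<noteq> {}"
  using assms by (auto simp: freqs_def elim!: evenE)

lemma abs_freqs_le:
  assumes "n \<in> freqs N"
  shows "\<bar>real_of_int n\<bar> \<le> real N / 2"
proof -
  have "2 * \<bar>n\<bar> \<le> int N"
    using assms by (auto simp: freqs_def)
  then have "real_of_int (2 * \<bar>n\<bar>) \<le> real_of_int (int N)"
    by (simp only: of_int_le_iff)
  then show ?thesis by simp
qed

text \<open>Quadratic decay of the quotients makes the alias series absolutely convergent in the sup-norm,
  and the sum of \<open>1 / r\<^sup>2\<close> over the nonzero integers is \<open>pi\<^sup>2 / 3\<close>.\<close>

lemma err_N_le:
  assumes "0 < N" "even N"
    and nz: "\<And>n. n \<in> freqs N \<Longrightarrow> fourier \<phi> (of_int n) \<noteq> 0"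
    and bnd: "\<And>n r. n \<in> freqs N \<Longrightarrow> r \<noteq> 0 \<Longrightarrow>
      cmod (fourier \<phi> (of_int (n + r * int N1)) / fourier \<phi> (of_int n)) \<le> C / (of_int r)\<^sup>2"
  shows "err_N N N1 \<phi> \<le> ereal (C * (pi\<^sup>2 / 3))"
proof -
  have sum: "((\<lambda>r. C / (of_int r)\<^sup>2) has_sum (C * (pi\<^sup>2 / 3))) (UNIV - {0 :: int})"
    using has_sum_cmult_right[OF inverse_squares_has_sum_int, of C] by simp
  have le: "norm (alias_term N1 \<phi> n r) \<le> C / (of_int r)\<^sup>2" if "n \<in> freqs N" "r \<in> UNIV - {0}" for n r
    unfolding alias_term_def using bnd[OF that(1), of r] that(2)
    by (intro order.trans[OF norm_scaled_exp_le]) auto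
  have abs: "(\<lambda>r. norm (alias_term N1 \<phi> n r)) summable_on (UNIV - {0})" if "n \<in> freqs N" for n
    by (rule Infinite_Sum.abs_summable_on_comparison_test'[OF has_sum_imp_summable[OF sum] le[OF that]])
  have norm_le: "norm (\<Sum>\<^sub>\<infinity>r\<in>UNIV - {0}. alias_term N1 \<phi> n r) \<le> C * (pi\<^sup>2 / 3)" if "n \<in> freqs N" for n
  proof -
    have "norm (\<Sum>\<^sub>\<infinity>r\<in>UNIV - {0}. alias_term N1 \<phi> n r) \<le> (\<Sum>\<^sub>\<infinity>r\<in>UNIV - {0}. norm (alias_term N1 \<phi> n r))"
      by (rule norm_infsum_bound[OF abs[OF that]])
    also have "\<dots> \<le> (\<Sum>\<^sub>\<infinity>r\<in>UNIV - {0 :: int}. C / (of_int r)\<^sup>2)"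
      by (intro infsum_mono abs[OF that] has_sum_imp_summable[OF sum] le[OF that])
    also have "\<dots> = C * (pi\<^sup>2 / 3)"
      by (rule infsumI[OF sum])
    finally show ?thesis .
  qed
  have "\<forall>n\<in>freqs N. fourier \<phi> (of_int n) \<noteq> 0 \<and> alias_term N1 \<phi> n summable_on (UNIV - {0})"
    using nz by (auto intro: Infinite_Sum.abs_summable_summable[OF abs])
  then have "err_N N N1 \<phi> = ereal (Max ((\<lambda>n. norm (\<Sum>\<^sub>\<infinity>r\<in>UNIV - {0}. alias_term N1 \<phi> n r)) ` freqs N))"
    unfolding err_N_def by (rule if_P)
  moreover have "Max ((\<lambda>n. norm (\<Sum>\<^sub>\<infinity>r\<in>UNIV - {0}. alias_term N1 \<phi> n r)) ` freqs N) \<le> C * (pi\<^sup>2 / 3)"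
    using freqs_nonempty[OF assms(1,2)] norm_le by (intro Max.boundedI) auto
  ultimately show ?thesis
    by (simp only: ereal_less_eq)
qed

text \<open>In the variable \<open>w = 2 * pi * m * v / N1\<close> the frequencies \<open>n\<close> lie in the interval \<open>\<bar>w\<bar> \<le> w0\<close>, while
  an alias \<open>n + r * N1\<close> satisfies \<open>\<bar>w\<bar> \<ge> 2 * pi * m * \<bar>r\<bar> - w0 \<ge> \<bar>r\<bar> * \<beta>\<close>. The choice
  \<open>\<beta> = 2 * pi * m - w0\<close> puts the end of the range where the transform is exponentially large
  exactly at the nearest possible alias,
  and \<open>\<beta> / \<bar>w\<bar> \<le> 1 / \<bar>r\<bar>\<close> is the reason why the resulting bound contains no trace of \<open>N\<close>.\<close>

lemma err_N_cKB_le: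
  fixes \<sigma> \<beta> :: real and m N N1 :: nat
  assumes \<sigma>: "\<sigma> > 1" and m: "m \<ge> 2"
    and N: "N > 0" "even N" and N1: "real N1 = \<sigma> * real N"
  defines "w0 \<equiv> pi * real m / \<sigma>" and "S \<equiv> 2 * pi * real m * sqrt (1 - 1 / \<sigma>)"
  assumes \<beta>: "\<beta> = 2 * pi * real m - w0"
    and pos: "sinh S / S - 1 / w0 > 0"
  shows "err_N N N1 (cKB m \<beta> N1) \<le> ereal (4 / (sinh S / S - 1 / w0))"
proof -
  define D where "D = sinh S / S - 1 / w0"
  define h where "h w = sinhc_sqrt (\<beta>\<^sup>2 - w\<^sup>2) - sinhc_sqrt (- (w\<^sup>2))" for w
  define K where "K = 2 * real m / (real N1 * (bessel_I0 \<beta> - 1))"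
  define w where "w v = 2 * pi * real m * v / real N1" for v :: real
  have w0: "0 < w0" using \<sigma> m by (simp add: w0_def)
  have S: "0 < S" using \<sigma> m by (simp add: S_def)
  have N1_pos: "0 < N1"
    using N1 \<sigma> N by (metis mult_pos_pos of_nat_0_less_iff less_trans zero_less_one)
  have S2: "S\<^sup>2 = \<beta>\<^sup>2 - w0\<^sup>2"
  proof -
    have "S\<^sup>2 = (2 * pi * real m)\<^sup>2 * (1 - 1 / \<sigma>)"
      using \<sigma> by (simp add: S_def power_mult_distrib)
    also have "\<dots> = (2 * pi * real m - w0)\<^sup>2 - w0\<^sup>2"
      using \<sigma> by (simp add: w0_def power2_eq_square field_simps)
    finally show ?thesis by (simp add: \<beta>)
  qed
  have \<beta>_ge: "2 * pi \<le> \<beta>"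
  proof -
    have "w0 \<le> pi * real m"
      using \<sigma> m by (simp add: w0_def field_simps)
    moreover have "pi * 2 \<le> pi * real m"
      using m by simp
    ultimately show ?thesis
      unfolding \<beta> mult.assoc by linarith
  qed
  have \<beta>_pos: "0 < \<beta>"
    using \<beta>_ge pi_gt_zero by linarith
  have K: "K \<noteq> 0"
    using bessel_I0_gt_1[of \<beta>] \<beta>_pos m N1_pos by (simp add: K_def)
  have fourier: "fourier (cKB m \<beta> N1) v = of_real (K * h (w v))" for v
    using fourier_cKB[of m N1 \<beta> v] m N1_pos by (simp add: K_def h_def w_def)
  have w_le: "\<bar>w (of_int n)\<bar> \<le> w0" if "n \<in> freqs N" for n
  proof -
    have "\<bar>w (of_int n)\<bar> = 2 * pi * real m / real N1 * \<bar>of_int n\<bar>"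
      by (simp add: w_def abs_mult)
    also have "\<dots> \<le> 2 * pi * real m / real N1 * (real N / 2)"
      by (intro mult_left_mono abs_freqs_le that) auto
    also have "\<dots> = w0"
      using N \<sigma> by (simp add: w0_def N1)
    finally show ?thesis .
  qed
  have h_ge: "D \<le> h (w (of_int n))" if "n \<in> freqs N" for n
    unfolding D_def h_def by (rule sinhc_sqrt_diff_lower_bound[OF w_le[OF that] w0 S S2])
  have h_le: "\<bar>h (w (of_int (n + r * int N1)))\<bar> \<le> 6 / 5 / (of_int r)\<^sup>2" if "n \<in> freqs N" "r \<noteq> 0" for n r
  proof -
    define v where "v = \<bar>w (of_int (n + r * int N1))\<bar>"
    have "w (of_int (n + r * int N1)) = 2 * pi * real m * of_int r + w (of_int n)"
      using N1_pos by (simp add: w_def field_simps)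
    then have "2 * pi * real m * of_int \<bar>r\<bar> - w0 \<le> v"
      using w_le[OF that(1)] abs_triangle_ineq2[of "2 * pi * real m * of_int r" "- w (of_int n)"]
      unfolding v_def by (simp add: abs_mult)
    moreover have r: "1 \<le> real_of_int \<bar>r\<bar>"
      using that(2) by linarith
    then have "w0 * 1 \<le> w0 * of_int \<bar>r\<bar>"
      using w0 by (intro mult_left_mono) auto
    ultimately have rv: "\<beta> * of_int \<bar>r\<bar> \<le> v"
      by (simp add: \<beta> algebra_simps)
    have "\<beta> * 1 \<le> \<beta> * of_int \<bar>r\<bar>"
      using r \<beta>_pos by (intro mult_left_mono) auto
    with rv have v: "\<beta> \<le> v" by linarith
    have "\<bar>h v\<bar> \<le> 6 / 5 * (\<beta> / v)\<^sup>2"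
      unfolding h_def by (rule sinhc_sqrt_diff_decay[OF \<beta>_ge v])
    also have "\<dots> \<le> 6 / 5 * (1 / of_int \<bar>r\<bar>)\<^sup>2"
    proof -
      have "\<beta> / v \<le> 1 / of_int \<bar>r\<bar>"
        using rv r v \<beta>_pos by (simp add: field_simps)
      then show ?thesis
        using v \<beta>_pos by (intro mult_left_mono power_mono) auto
    qed
    also have "h v = h (w (of_int (n + r * int N1)))"
      by (simp add: h_def v_def)
    finally show ?thesis by (simp add: power_divide)
  qed
  have D: "0 < D" using pos by (simp add: D_def)
  have "err_N N N1 (cKB m \<beta> N1) \<le> ereal (6 / 5 / D * (pi\<^sup>2 / 3))"
  proof (rule err_N_le[OF N])
    fix n assume n: "n \<in> freqs N"
    then have hn: "0 < h (w (of_int n))"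
      using h_ge D by fastforce
    with K show "fourier (cKB m \<beta> N1) (of_int n) \<noteq> 0"
      by (simp add: fourier)
    fix r :: int assume r: "r \<noteq> 0"
    have "cmod (fourier (cKB m \<beta> N1) (of_int (n + r * int N1)) / fourier (cKB m \<beta> N1) (of_int n))
      = \<bar>h (w (of_int (n + r * int N1)))\<bar> / h (w (of_int n))"
      unfolding fourier of_real_divide[symmetric] norm_of_real using K hn by (simp add: abs_mult)
    also have "\<dots> \<le> (6 / 5 / (of_int r)\<^sup>2) / D"
      using h_le[OF n r] h_ge[OF n] D by (intro frac_le) auto
    finally show "cmod (fourier (cKB m \<beta> N1) (of_int (n + r * int N1)) / fourier (cKB m \<beta> N1) (of_int n))
      \<le> 6 / 5 / D / (of_int r)\<^sup>2"
      by (simp only: divide_divide_eq_left mult_ac)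
  qed
  also have "6 / 5 / D * (pi\<^sup>2 / 3) \<le> 4 / D"
  proof -
    \<comment> \<open>The constants meet because \<open>pi\<^sup>2 < 10\<close>.\<close>
    have "pi\<^sup>2 \<le> 3.15\<^sup>2"
      using pi_approx(2) by (intro power_mono) auto
    then have "2 / 5 * pi\<^sup>2 \<le> 4"
      by (simp add: power2_eq_square)
    then have "2 / 5 * pi\<^sup>2 / D \<le> 4 / D"
      using D by (intro divide_right_mono) auto
    then show ?thesis by simp
  qed
  finally show ?thesis by (simp add: D_def)
qed

section \<open>The error constant\<close>

theorem theorem4p5:
  fixes \<sigma> b \<beta> :: real and m N N1 :: nat
  assumes "\<sigma> > 1"
    and "b = 2 * pi * (1 - 1 / (2 * \<sigma>))"
    and "\<beta> = b * real m"
    and "N > 0" and "even N"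
    and "real N1 = \<sigma> * real N" and "even N1"
    and "m \<ge> 2" and "2 * m < N1"
    and "exp (2 * pi * real m * sqrt (1 - 1 / \<sigma>)) - exp (- (2 * pi * real m * sqrt (1 - 1 / \<sigma>)))
           - 4 * sqrt (\<sigma>\<^sup>2 - \<sigma>) > 0"
  shows "err \<sigma> (cKB m \<beta>) \<le>
    ereal (16 * real m * pi * sqrt (1 - 1 / \<sigma>)
      * inverse (exp (2 * pi * real m * sqrt (1 - 1 / \<sigma>)) - exp (- (2 * pi * real m * sqrt (1 - 1 / \<sigma>)))
           - 4 * sqrt (\<sigma>\<^sup>2 - \<sigma>)))"
proof -
  define w0 where "w0 = pi * real m / \<sigma>"
  define S where "S = 2 * pi * real m * sqrt (1 - 1 / \<sigma>)"
  define D where "D = sinh S / S - 1 / w0"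
  have S: "0 < S" using assms(1,8) by (simp add: S_def)
  \<comment> \<open>The bracket in the claim is the lower bound for the denominators, up to the factor \<open>2 * S\<close>.\<close>
  have bracket: "exp S - exp (- S) - 4 * sqrt (\<sigma>\<^sup>2 - \<sigma>) = 2 * S * D"
  proof -
    have "\<sigma>\<^sup>2 - \<sigma> = \<sigma>\<^sup>2 * (1 - 1 / \<sigma>)"
      using assms(1) by (simp add: power2_eq_square field_simps)
    then have "sqrt (\<sigma>\<^sup>2 - \<sigma>) = \<sigma> * sqrt (1 - 1 / \<sigma>)"
      using assms(1) by (simp add: real_sqrt_mult)
    then have "4 * sqrt (\<sigma>\<^sup>2 - \<sigma>) = 2 * S * (1 / w0)"
      using assms(1,8) by (simp add: S_def w0_def)
    moreover have "exp S - exp (- S) = 2 * S * (sinh S / S)"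
      using S by (simp add: sinh_field_def)
    ultimately show ?thesis
      by (simp add: D_def right_diff_distrib)
  qed
  have D: "0 < D"
    using assms(10) S bracket by (simp add: S_def[symmetric] zero_less_mult_iff)
  have \<beta>: "\<beta> = 2 * pi * real m - w0"
    using assms(1) by (simp add: assms(2,3) w0_def field_simps)
  have "err \<sigma> (cKB m \<beta>) \<le> ereal (4 / D)"
    unfolding err_def
  proof (rule SUP_least, clarify)
    fix M M1 :: nat
    assume "0 < M" "even M" "real M1 = \<sigma> * real M"
    then show "err_N M M1 (cKB m \<beta> M1) \<le> ereal (4 / D)"
      using err_N_cKB_le[of \<sigma> m M M1 \<beta>] assms(1,8) \<beta> D by (simp add: D_def S_def w0_def)
  qed
  also have "4 / D = 8 * S * inverse (2 * S * D)"
    using S D by (simp add: field_simps)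
  also have "\<dots> = 16 * real m * pi * sqrt (1 - 1 / \<sigma>)
      * inverse (exp S - exp (- S) - 4 * sqrt (\<sigma>\<^sup>2 - \<sigma>))"
    unfolding bracket by (simp add: S_def)
  finally show ?thesis
    by (simp only: S_def)
qed

end
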